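(* Let $S=\{1,s_1,\ldots,s_r\}$ be a set of positive integers, where $r\ge 1$. If for every $i\in\{1,\ldots,r\}$ we have $\sum_{j=1,\, j\ne i}^{r} s_j\ge s_i-1$, then there exists a $\chi_\rho$-critical graph $G$ such that $\{\chi_\rho(G)-\chi_\rho(G-x) : x\in V(G)\}=S$.
   Context: Graphs are finite, simple and undirected, with nonempty vertex set. Distance is shortest-path distance ($\infty$ between different components). For a positive integer $i$, an $i$-packing in $G$ is a set of vertices such that any two distinct vertices in it are at distance greater than $i$. The packing chromatic number $\chi_\rho(G)$ is the smallest integer $k$ such that $V(G)$ can be partitioned into (possibly empty) sets $V_1,\ldots,V_k$ with $V_i$ an $i$-packing for each $i\in\{1,\ldots,k\}$; the graph with no vertices (arising only as $K_1-x$) has value $0$. $G-x$ denotes the graph obtained from $G$ by deleting the vertex $x$. A graph $G$ is $\chi_\rho$-critical if $\chi_\rho(G-x)<\chi_\rho(G)$ for every vertex $x$ of $G$. *)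

theory Defs
  imports "Graph_Theory.Graph_Theory"
begin

text \<open>
  Finite simple undirected graphs are the symmetric digraphs of the locale \<^locale>\<open>graph\<close>, in which
  an undirected edge is a pair of opposite arcs. That locale admits the empty vertex set, so
  non-emptiness is a separate requirement.
\<close>

text \<open>Shortest-path distance: all arcs have weight 1, and the value is infinite without a walk.\<close>

definition graph_dist :: "('a, 'b) pre_digraph \<Rightarrow> 'a \<Rightarrow> 'a \<Rightarrow> ereal" where
  "graph_dist G u v = wf_digraph.\<mu> G (\<lambda>_. 1) u v"

definition packing :: "('a, 'b) pre_digraph \<Rightarrow> nat \<Rightarrow> 'a set \<Rightarrow> bool" where
  "packing G i A \<longleftrightarrow>
     A \<subseteq> verts G \<and> (\<forall>u\<in>A. \<forall>v\<in>A. u \<noteq> v \<longrightarrow> ereal (real i) < graph_dist G u v)"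

definition packing_colorable :: "('a, 'b) pre_digraph \<Rightarrow> nat \<Rightarrow> bool" where
  "packing_colorable G k \<longleftrightarrow>
     (\<exists>V :: nat \<Rightarrow> 'a set.
        (\<Union>i\<in>{1..k}. V i) = verts G \<and> disjoint_family_on V {1..k} \<and>
        (\<forall>i\<in>{1..k}. packing G i (V i)))"

definition packing_chromatic_number :: "('a, 'b) pre_digraph \<Rightarrow> nat" where
  "packing_chromatic_number G = (LEAST k. packing_colorable G k)"

lemma packing_colorable_card:
  assumes "finite (verts G)"
  shows "packing_colorable G (card (verts G))"
proof -
  define n where "n = card (verts G)"
  obtain f where f: "bij_betw f {1..n} (verts G)"
    using ex_bij_betw_nat_finite_1[OF assms] unfolding n_def by blast
  have inj: "inj_on f {1..n}" and im: "f ` {1..n} = verts G"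
    using f unfolding bij_betw_def by blast+
  have "disjoint_family_on (\<lambda>i. {f i}) {1..n}"
    unfolding disjoint_family_on_def
  proof (intro ballI impI)
    fix i j assume "i \<in> {1..n}" "j \<in> {1..n}" "i \<noteq> j"
    then have "f i \<noteq> f j" using inj_onD[OF inj] by blast
    then show "{f i} \<inter> {f j} = {}" by simp
  qed
  moreover have "(\<Union>i\<in>{1..n}. {f i}) = verts G"
    using im by blast
  moreover have "packing G i {f i}" if "i \<in> {1..n}" for i
  proof -
    have "f i \<in> verts G" using im that by blast
    then show ?thesis by (simp add: packing_def)
  qed
  ultimately show ?thesis
    unfolding packing_colorable_def n_def by (intro exI[of _ "\<lambda>i. {f i}"]) blast
qed

lemma packing_chromatic_number_no_verts:
  "verts G = {} \<Longrightarrow> packing_chromatic_number G = 0"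
  using packing_colorable_card[of G] by (simp add: packing_chromatic_number_def Least_eq_0)

definition chi_rho_critical :: "('a, 'b) pre_digraph \<Rightarrow> bool" where
  "chi_rho_critical G \<longleftrightarrow>
     (\<forall>x\<in>verts G.
        packing_chromatic_number (pre_digraph.del_vert G x) < packing_chromatic_number G)"

end

theory Submission
  imports Defs
begin

text \<open>
  Take hubs \<open>x\<^sub>1, \<dots>, x\<^sub>r\<close> forming a clique and attach to each \<open>x\<^sub>i\<close> a private set \<open>Q\<^sub>i\<close> of
  \<open>s\<^sub>i + 1\<close> vertices such that \<open>Q\<^sub>i \<union> {x\<^sub>i}\<close> is a clique, the \<open>i\<close>-th block. For \<open>r \<ge> 2\<close> this graph
  has diameter 3, so only the colours 1 and 2 can be repeated, and each of them occurs at most once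
  in every block. Two vertices lying in \<open>Q\<^sub>i\<close> and \<open>Q\<^sub>j\<close> with \<open>i \<noteq> j\<close> are at distance 3, so both
  colours can indeed be used once in every block. Hence, with \<open>\<Sigma> = s\<^sub>1 + \<dots> + s\<^sub>r\<close>, the packing
  chromatic number is \<open>(\<Sigma> + 2 r) - 2 r + 2 = \<Sigma> + 2\<close>.

  If a vertex of \<open>Q\<^sub>i\<close> is deleted, the same count applies with one vertex less, and the value drops by
  exactly 1. When only one vertex of \<open>Q\<^sub>i\<close> is left, the hub \<open>x\<^sub>i\<close> serves as the representative of
  its block in the first colour class.

  If the hub \<open>x\<^sub>i\<close> is deleted, the clique \<open>Q\<^sub>i\<close> becomes a component of its own and can reuse the
  colours of the other one, which is the same kind of graph with \<open>r - 1\<close> blocks and needs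
  \<open>\<Sigma> - s\<^sub>i + 2\<close> colours. These suffice for the \<open>s\<^sub>i + 1\<close> vertices of \<open>Q\<^sub>i\<close> exactly when
  \<open>s\<^sub>i - 1 \<le> \<Sigma> - s\<^sub>i\<close>, which is the hypothesis on the \<open>s\<^sub>i\<close>; so the value drops by \<open>s\<^sub>i\<close>.

  For \<open>r = 1\<close> the hypothesis forces \<open>s\<^sub>1 = 1\<close>, and the sequence \<open>1, 1\<close> describes the same set
  \<open>S = {1}\<close>.

  All three values are instances of \<open>packing_chromatic_number_hub_graph\<close>, which computes the packing
  chromatic number of a graph made of one such block structure together with hubless cliques that are
  small enough to be coloured for free.
\<close>

section \<open>Distances in terms of walks\<close>

lemma less_graph_dist_iff:
  assumes "wf_digraph G"
  shows "ereal (real i) < graph_dist G u v \<longleftrightarrow>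
    (\<forall>p. pre_digraph.awalk G u p v \<longrightarrow> i < length p)"
proof -
  interpret wf_digraph G by fact
  have cost: "awalk_cost (\<lambda>_. 1) p = real (length p)" for p :: "'b awalk"
    by (induction p) auto
  show ?thesis
  proof
    assume less: "ereal (real i) < graph_dist G u v"
    show "\<forall>p. awalk u p v \<longrightarrow> i < length p"
    proof (intro allI impI)
      fix p assume "awalk u p v"
      then have "graph_dist G u v \<le> ereal (real (length p))"
        unfolding graph_dist_def \<mu>_def cost by (auto intro: INF_lower)
      with less have "ereal (real i) < ereal (real (length p))"
        by (rule less_le_trans)
      then show "i < length p" by simp
    qed
  next
    assume long: "\<forall>p. awalk u p v \<longrightarrow> i < length p"
    have "ereal (real (Suc i)) \<le> graph_dist G u v"
      unfolding graph_dist_def \<mu>_def cost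
      by (rule INF_greatest) (use long in \<open>auto simp del: of_nat_Suc simp: Suc_le_eq\<close>)
    then show "ereal (real i) < graph_dist G u v"
      by (rule less_le_trans[rotated]) simp
  qed
qed

lemma packing_colorableI:
  assumes "\<And>v. v \<in> verts G \<Longrightarrow> c v \<in> {1..k}"
    and "\<And>u v. \<lbrakk>u \<in> verts G; v \<in> verts G; u \<noteq> v; c u = c v\<rbrakk> \<Longrightarrow> ereal (real (c u)) < graph_dist G u v"
  shows "packing_colorable G k"
  unfolding packing_colorable_def
proof (intro exI conjI ballI)
  show "(\<Union>i\<in>{1..k}. {v \<in> verts G. c v = i}) = verts G"
    using assms(1) by auto
  show "disjoint_family_on (\<lambda>i. {v \<in> verts G. c v = i}) {1..k}"
    by (auto simp: disjoint_family_on_def)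
  show "packing G i {v \<in> verts G. c v = i}" for i
    unfolding packing_def using assms(2) by (metis (mono_tags, lifting) mem_Collect_eq subsetI)
qed

section \<open>Cliques joined through their hubs\<close>

text \<open>
  Adjacency depends only on the labels of the two vertices, so deleting a vertex just shrinks \<open>W\<close> and
  stays within this family.
\<close>

definition hub_graph :: "('a \<Rightarrow> 'b) \<Rightarrow> ('a \<Rightarrow> bool) \<Rightarrow> 'a set \<Rightarrow> ('a, 'a \<times> 'a) pre_digraph" where
  "hub_graph grp hub W =
     \<lparr>verts = W,
      arcs = {(u, v). u \<in> W \<and> v \<in> W \<and> u \<noteq> v \<and> (grp u = grp v \<or> hub u \<and> hub v)},
      tail = fst, head = snd\<rparr>"

lemma verts_hub_graph [simp]: "verts (hub_graph grp hub W) = W"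
  by (simp add: hub_graph_def)

lemma mem_arcs_hub_graph_iff [simp]:
  "e \<in> arcs (hub_graph grp hub W) \<longleftrightarrow>
     fst e \<in> W \<and> snd e \<in> W \<and> fst e \<noteq> snd e \<and>
     (grp (fst e) = grp (snd e) \<or> hub (fst e) \<and> hub (snd e))"
  by (auto simp: hub_graph_def)

lemma del_vert_hub_graph:
  "pre_digraph.del_vert (hub_graph grp hub W) x = hub_graph grp hub (W - {x})"
  by (auto simp: pre_digraph.del_vert_def hub_graph_def)

lemma wf_digraph_hub_graph: "wf_digraph (hub_graph grp hub W)"
  by unfold_locales (auto simp: hub_graph_def)

lemma graph_hub_graph:
  assumes "finite W"
  shows "graph (hub_graph grp hub W)"
proof -
  have "finite (arcs (hub_graph grp hub W))"
    by (rule finite_subset[of _ "W \<times> W"]) (use assms in \<open>auto simp: hub_graph_def\<close>)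
  then show ?thesis
    using assms
    by unfold_locales
      (auto simp: hub_graph_def arc_to_ends_def arcs_ends_def symmetric_def sym_def image_iff)
qed

lemma awalk_hub_graph_Nil [simp]:
  "pre_digraph.awalk (hub_graph grp hub W) u [] v \<longleftrightarrow> u = v \<and> u \<in> W"
  using wf_digraph.awalk_Nil_iff[OF wf_digraph_hub_graph] by fastforce

lemma awalk_hub_graph_Cons [simp]:
  "pre_digraph.awalk (hub_graph grp hub W) u (e # p) v \<longleftrightarrow>
     e \<in> arcs (hub_graph grp hub W) \<and> fst e = u \<and>
     pre_digraph.awalk (hub_graph grp hub W) (snd e) p v"
  using wf_digraph.awalk_Cons_iff[OF wf_digraph_hub_graph, of grp hub W u e p v]
  by (auto simp: hub_graph_def)

lemmas less_dist_hub_graph_iff = less_graph_dist_iff[OF wf_digraph_hub_graph]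

lemma one_less_dist:
  assumes "grp u \<noteq> grp v" "\<not> (hub u \<and> hub v)"
  shows "ereal (real 1) < graph_dist (hub_graph grp hub W) u v"
  unfolding less_dist_hub_graph_iff
proof (intro allI impI)
  fix p assume "pre_digraph.awalk (hub_graph grp hub W) u p v"
  then show "1 < length p"
    using assms by (cases p; cases "tl p") auto
qed

lemma two_less_dist:
  assumes "grp u \<noteq> grp v" "\<not> hub u" "\<not> hub v"
  shows "ereal (real 2) < graph_dist (hub_graph grp hub W) u v"
  unfolding less_dist_hub_graph_iff
proof (intro allI impI)
  fix p assume "pre_digraph.awalk (hub_graph grp hub W) u p v"
  then show "2 < length p"
    using assms by (cases p; cases "tl p"; cases "tl (tl p)") auto
qed

text \<open>
  A walk can leave a block only through a hub, so the vertices of blocks without a hub are at infinite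
  distance from all other blocks.
\<close>

lemma less_dist_hubless:
  assumes "\<And>w. w \<in> W - R \<Longrightarrow> \<not> hub w"
    and "grp ` (W - R) \<inter> grp ` R = {}"
    and "u \<in> W - R" "v \<in> R"
  shows "ereal (real i) < graph_dist (hub_graph grp hub W) u v"
    and "ereal (real i) < graph_dist (hub_graph grp hub W) v u"
proof -
  have no1: "y \<notin> R" if "pre_digraph.awalk (hub_graph grp hub W) x p y" "x \<in> W - R" for p x y
    using that
  proof (induction p arbitrary: x)
    case (Cons e p)
    then have "snd e \<in> W" "grp (snd e) = grp x \<or> hub x"
      by auto
    with assms(1,2) Cons.prems have "snd e \<in> W - R" by fastforce
    with Cons show ?case by auto
  qed auto
  have no2: "y \<in> R" if "pre_digraph.awalk (hub_graph grp hub W) x p y" "x \<in> R" for p x y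
    using that
  proof (induction p arbitrary: x)
    case (Cons e p)
    then have "snd e \<in> W" "grp (snd e) = grp x \<or> hub (snd e)"
      by auto
    with assms(1,2) Cons.prems have "snd e \<in> R" by fastforce
    with Cons show ?case by auto
  qed auto
  show "ereal (real i) < graph_dist (hub_graph grp hub W) u v"
    unfolding less_dist_hub_graph_iff using no1 assms(3,4) by blast
  show "ereal (real i) < graph_dist (hub_graph grp hub W) v u"
    unfolding less_dist_hub_graph_iff using no2 assms(3,4) by blast
qed

lemma dist_le_one:
  assumes "u \<in> W" "v \<in> W" "grp u = grp v" "i \<ge> 1"
  shows "\<not> ereal (real i) < graph_dist (hub_graph grp hub W) u v"
proof -
  have "pre_digraph.awalk (hub_graph grp hub W) u (if u = v then [] else [(u, v)]) v"
    using assms by simp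
  moreover have "length (if u = v then [] else [(u, v)]) \<le> i"
    using assms(4) by simp
  ultimately show ?thesis
    unfolding less_dist_hub_graph_iff by fastforce
qed

lemma dist_le_three:
  assumes "u \<in> W" "v \<in> W" "i \<ge> 3"
    and "x \<in> W" "hub x" "grp x = grp u"
    and "y \<in> W" "hub y" "grp y = grp v"
  shows "\<not> ereal (real i) < graph_dist (hub_graph grp hub W) u v"
proof -
  \<comment> \<open>The walk from \<open>u\<close> to \<open>v\<close> via the two hubs, omitting the steps that would be loops.\<close>
  define step where "step = (\<lambda>a b :: 'a. if a = b then [] else [(a, b)])"
  have "pre_digraph.awalk (hub_graph grp hub W) u (step u x @ step x y @ step y v) v"
    using assms by (auto simp: step_def)
  moreover have "length (step u x @ step x y @ step y v) \<le> i"
    using assms(3) by (simp add: step_def)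
  ultimately show ?thesis
    unfolding less_dist_hub_graph_iff by fastforce
qed

section \<open>The packing chromatic number of a hub graph\<close>

text \<open>
  In the part \<open>R\<close> of the graph whose blocks have hubs, all distances are at most 3 and blocks are
  cliques. So the classes of colours 1 and 2 meet \<open>R\<close> in at most one vertex per block and every other
  class meets it in at most one vertex; summing over the classes gives the bound.
\<close>

lemma packing_colorable_hub_graph_ge:
  assumes W: "finite W" and R: "R \<subseteq> W" "R \<noteq> {}"
    and hubs: "\<And>u. u \<in> R \<Longrightarrow> \<exists>x\<in>W. hub x \<and> grp x = grp u"
    and col: "packing_colorable (hub_graph grp hub W) k"
  shows "card R + 2 \<le> k + 2 * card (grp ` R)"
proof -
  let ?t = "card (grp ` R)"
  have fin: "finite R" using W R finite_subset by blast
  have t: "?t \<ge> 1" using fin R by (simp add: Suc_le_eq card_gt_0_iff)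
  obtain V where V: "(\<Union>i\<in>{1..k}. V i) = W"
    and pack: "\<And>i. i \<in> {1..k} \<Longrightarrow> packing (hub_graph grp hub W) i (V i)"
    using col unfolding packing_colorable_def by auto
  have "card R = card (\<Union>i\<in>{1..k}. V i \<inter> R)"
    using V R by (intro arg_cong[of _ _ card]) blast
  also have "\<dots> \<le> (\<Sum>i\<in>{1..k}. card (V i \<inter> R))"
    by (rule card_UN_le) simp
  also have "\<dots> \<le> (\<Sum>i\<in>{1..k}. if i \<le> 2 then ?t else 1)"
  proof (rule sum_mono)
    fix i assume i: "i \<in> {1..k}"
    show "card (V i \<inter> R) \<le> (if i \<le> 2 then ?t else 1)"
    proof (cases "i \<le> 2")
      case True
      have "inj_on grp (V i \<inter> R)"
      proof (rule inj_onI, rule ccontr)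
        fix u v assume "u \<in> V i \<inter> R" "v \<in> V i \<inter> R" "grp u = grp v" "u \<noteq> v"
        then show False
          using pack[OF i] dist_le_one[of u W v grp i hub] i R
          unfolding packing_def by auto
      qed
      then have "card (V i \<inter> R) \<le> ?t"
        by (rule card_inj_on_le) (use fin in auto)
      then show ?thesis using True by simp
    next
      case False
      have "u = v" if uv: "u \<in> V i \<inter> R" "v \<in> V i \<inter> R" for u v
      proof (rule ccontr)
        assume "u \<noteq> v"
        obtain x y where "x \<in> W" "hub x" "grp x = grp u" "y \<in> W" "hub y" "grp y = grp v"
          using hubs uv by blast
        with \<open>u \<noteq> v\<close> show False
          using pack[OF i] dist_le_three[of u W v i x hub grp y] False uv R
          unfolding packing_def by auto
      qed
      then have "card (V i \<inter> R) \<le> 1"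
        using fin by (simp add: card_le_Suc0_iff_eq)
      then show ?thesis using False by simp
    qed
  qed
  also have "\<dots> = (\<Sum>i\<in>{1..k}. 1 + (if i \<le> 2 then ?t - 1 else 0))"
    using t by (intro sum.cong) auto
  also have "\<dots> = k + card {i \<in> {1..k}. i \<le> 2} * (?t - 1)"
    unfolding sum.distrib by (simp flip: sum.inter_filter)
  also have "\<dots> \<le> k + 2 * (?t - 1)"
  proof -
    have "card {i \<in> {1..k}. i \<le> 2} \<le> card {1, 2 :: nat}"
      by (rule card_mono) auto
    then show ?thesis by simp
  qed
  finally show ?thesis using t by simp
qed

text \<open>
  Colour \<open>A\<close> with 1, the rest of \<open>B\<close> with 2 and the remaining vertices of \<open>R\<close> with distinct further colours. The
  hubless rest \<open>W - R\<close> is infinitely far from \<open>R\<close>, so it may use the same palette, each colour at most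
  once.
\<close>

lemma packing_colorable_hub_graph:
  assumes W: "finite W" and R: "R \<subseteq> W"
    and A: "A \<subseteq> R" "inj_on grp A" "\<And>u v. \<lbrakk>u \<in> A; v \<in> A; hub u; hub v\<rbrakk> \<Longrightarrow> u = v"
    and B: "B \<subseteq> R" "inj_on grp B" "\<And>u. u \<in> B \<Longrightarrow> \<not> hub u"
    and rest: "\<And>w. w \<in> W - R \<Longrightarrow> \<not> hub w" "grp ` (W - R) \<inter> grp ` R = {}"
      "card (W - R) \<le> card (R - (A \<union> B)) + 2"
  shows "packing_colorable (hub_graph grp hub W) (card (R - (A \<union> B)) + 2)"
proof -
  let ?n = "card (R - (A \<union> B))"
  have fin: "finite (R - (A \<union> B))" "finite (W - R)"
    using W R finite_subset by blast+
  obtain f where f: "bij_betw f (R - (A \<union> B)) {0..<?n}"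
    using ex_bij_betw_finite_nat[OF fin(1)] by blast
  obtain g where g: "bij_betw g (W - R) {0..<card (W - R)}"
    using ex_bij_betw_finite_nat[OF fin(2)] by blast
  define c where "c v = (if v \<notin> R then g v + 1 else if v \<in> A then 1
    else if v \<in> B then 2 else f v + 3)" for v
  show ?thesis
  proof (rule packing_colorableI[of _ c])
    fix v assume v: "v \<in> verts (hub_graph grp hub W)"
    have "g v < card (W - R)" if "v \<notin> R"
      using bij_betw_apply[OF g, of v] v that by auto
    moreover have "f v < ?n" if "v \<in> R - (A \<union> B)"
      using bij_betw_apply[OF f, of v] that by auto
    ultimately show "c v \<in> {1..?n + 2}"
      using rest(3) by (auto simp: c_def)
  next
    fix u v
    assume "u \<in> verts (hub_graph grp hub W)" "v \<in> verts (hub_graph grp hub W)"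
    then have uv: "u \<in> W" "v \<in> W" by auto
    assume neq: "u \<noteq> v" and same: "c u = c v"
    consider "u \<in> R" "v \<in> R" | "u \<in> W - R" "v \<in> R" | "u \<in> R" "v \<in> W - R"
      | "u \<in> W - R" "v \<in> W - R"
      using uv by blast
    then show "ereal (real (c u)) < graph_dist (hub_graph grp hub W) u v"
    proof cases
      case 1
      then consider "u \<in> A" "v \<in> A" | "u \<in> B - A" "v \<in> B - A"
        | "u \<in> R - (A \<union> B)" "v \<in> R - (A \<union> B)" "f u = f v"
        using same by (auto simp: c_def split: if_splits)
      then show ?thesis
      proof cases
        case 1
        then have "c u = 1" using A by (auto simp: c_def)
        moreover have "grp u \<noteq> grp v" "\<not> (hub u \<and> hub v)"
          using 1 A neq by (auto dest: inj_onD)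
        ultimately show ?thesis using one_less_dist[of grp u v hub W] by metis
      next
        case 2
        then have "c u = 2" using B by (auto simp: c_def)
        moreover have "grp u \<noteq> grp v" "\<not> hub u" "\<not> hub v"
          using 2 B neq by (auto dest: inj_onD)
        ultimately show ?thesis using two_less_dist[of grp u v hub W] by metis
      next
        case 3
        then show ?thesis using f neq by (auto simp: bij_betw_def dest: inj_onD)
      qed
    next
      case 2
      then show ?thesis using rest(1,2) by (intro less_dist_hubless(1)[where R = R]) auto
    next
      case 3
      then show ?thesis using rest(1,2) by (intro less_dist_hubless(2)[where R = R]) auto
    next
      case 4
      then show ?thesis using same neq g by (auto simp: c_def bij_betw_def dest: inj_onD)
    qed
  qed
qed

text \<open>
  If \<open>A\<close> and \<open>B\<close> contain one vertex of every block of \<open>R\<close>, they reach the maximal sizes of the first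
  two colour classes, and the two bounds meet. The set \<open>A\<close> may contain a single hub, because its
  vertices need only be pairwise nonadjacent, whereas those of \<open>B\<close> must be at distance 3.
\<close>

lemma packing_chromatic_number_hub_graph:
  assumes W: "finite W" and R: "R \<subseteq> W" "R \<noteq> {}"
    and A: "A \<subseteq> R" "bij_betw grp A (grp ` R)" "\<And>u v. \<lbrakk>u \<in> A; v \<in> A; hub u; hub v\<rbrakk> \<Longrightarrow> u = v"
    and B: "B \<subseteq> R" "bij_betw grp B (grp ` R)" "\<And>u. u \<in> B \<Longrightarrow> \<not> hub u"
    and disj: "A \<inter> B = {}"
    and hubs: "\<And>u. u \<in> R \<Longrightarrow> \<exists>x\<in>W. hub x \<and> grp x = grp u"
    and rest: "\<And>w. w \<in> W - R \<Longrightarrow> \<not> hub w" "grp ` (W - R) \<inter> grp ` R = {}"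
      "card (W - R) + 2 * card (grp ` R) \<le> card R + 2"
  shows "packing_chromatic_number (hub_graph grp hub W) + 2 * card (grp ` R) = card R + 2"
proof -
  have fin: "finite R" "finite A" "finite B"
    using W R A B finite_subset by metis+
  have "card (A \<union> B) = 2 * card (grp ` R)"
    using card_Un_disjoint[OF fin(2,3) disj] A(2) B(2) by (simp add: bij_betw_same_card)
  moreover have "card (R - (A \<union> B)) + card (A \<union> B) = card R"
    using fin A(1) B(1) by (metis Un_least card_Diff_subset card_mono finite_UnI le_add_diff_inverse2)
  ultimately have card: "card (R - (A \<union> B)) + 2 * card (grp ` R) = card R"
    by simp
  have "packing_chromatic_number (hub_graph grp hub W) = card (R - (A \<union> B)) + 2"
    unfolding packing_chromatic_number_def
  proof (rule Least_equality)
    show "packing_colorable (hub_graph grp hub W) (card (R - (A \<union> B)) + 2)"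
      by (rule packing_colorable_hub_graph)
        (use assms card in \<open>auto simp: bij_betw_def\<close>)
  next
    fix k assume "packing_colorable (hub_graph grp hub W) k"
    from packing_colorable_hub_graph_ge[OF W R hubs this] card
    show "card (R - (A \<union> B)) + 2 \<le> k" by simp
  qed
  with card show ?thesis by simp
qed

section \<open>The critical graphs\<close>

text \<open>
  The pair \<open>(j, 0)\<close> is the hub of block \<open>j\<close>, and \<open>(j, 1), \<dots>, (j, s j + 1)\<close> are its other vertices.
  Pairs are coded by natural numbers to obtain a graph on type \<^typ>\<open>nat\<close>.
\<close>

definition blocks :: "(nat \<Rightarrow> nat) \<Rightarrow> nat set \<Rightarrow> nat set" where
  "blocks s J = prod_encode ` (SIGMA j:J. {0..s j + 1})"

abbreviation block_graph :: "nat set \<Rightarrow> (nat, nat \<times> nat) pre_digraph" where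
  "block_graph W \<equiv> hub_graph (\<lambda>v. fst (prod_decode v)) (\<lambda>v. snd (prod_decode v) = 0) W"

lemma finite_blocks: "finite J \<Longrightarrow> finite (blocks s J)"
  by (simp add: blocks_def)

lemma prod_encode_in_blocks_iff [simp]:
  "prod_encode (j, b) \<in> blocks s J \<longleftrightarrow> j \<in> J \<and> b \<le> s j + 1"
  by (auto simp: blocks_def prod_encode_eq)

lemma card_blocks:
  assumes "finite J"
  shows "card (blocks s J) = sum s J + 2 * card J"
proof -
  have "card (blocks s J) = (\<Sum>j\<in>J. s j + 2)"
    using assms by (simp add: blocks_def card_image inj_prod_encode)
  then show ?thesis by (simp only: sum.distrib) simp
qed

lemma groups_blocks: "(\<lambda>v. fst (prod_decode v)) ` blocks s J = J"
  by (force simp: blocks_def image_image)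

lemma blocks_eq_empty_iff [simp]: "blocks s J = {} \<longleftrightarrow> J = {}"
  using groups_blocks[of s J] by (metis image_is_empty)

lemma blocksE:
  assumes "v \<in> blocks s J"
  obtains j b where "v = prod_encode (j, b)" "j \<in> J" "b \<le> s j + 1"
  using assms by (auto simp: blocks_def)

lemma bij_betw_transversal:
  "bij_betw (\<lambda>v. fst (prod_decode v)) ((\<lambda>j. prod_encode (j, a j)) ` J) J"
  by (rule bij_betw_byWitness[of _ "\<lambda>j. prod_encode (j, a j)"]) auto

lemma packing_chromatic_number_blocks:
  assumes "finite J" "J \<noteq> {}" "\<And>j. j \<in> J \<Longrightarrow> s j \<ge> 1"
  shows "packing_chromatic_number (block_graph (blocks s J)) = sum s J + 2"
proof -
  let ?W = "blocks s J"
  have "packing_chromatic_number (block_graph ?W) + 2 * card ((\<lambda>v. fst (prod_decode v)) ` ?W)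
      = card ?W + 2"
  proof (rule packing_chromatic_number_hub_graph
      [of ?W ?W "(\<lambda>j. prod_encode (j, 1)) ` J" _ _ "(\<lambda>j. prod_encode (j, 2)) ` J"])
    show "\<exists>x\<in>?W. snd (prod_decode x) = 0 \<and> fst (prod_decode x) = fst (prod_decode u)"
      if "u \<in> ?W" for u
      using that by (elim blocksE) (auto intro!: bexI[of _ "prod_encode (fst (prod_decode u), 0)"])
    show "bij_betw (\<lambda>v. fst (prod_decode v)) ((\<lambda>j. prod_encode (j, 1)) ` J)
        ((\<lambda>v. fst (prod_decode v)) ` ?W)"
      "bij_betw (\<lambda>v. fst (prod_decode v)) ((\<lambda>j. prod_encode (j, 2)) ` J)
        ((\<lambda>v. fst (prod_decode v)) ` ?W)"
      unfolding groups_blocks by (rule bij_betw_transversal)+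
    show "?W \<noteq> {}" using assms(2) by simp
    show "card (?W - ?W) + 2 * card ((\<lambda>v. fst (prod_decode v)) ` ?W) \<le> card ?W + 2"
      by (simp add: groups_blocks card_blocks assms)
  qed (use assms in \<open>auto simp: finite_blocks\<close>)
  then show ?thesis by (simp add: groups_blocks card_blocks assms)
qed

text \<open>
  Block \<open>i\<close> may be left with its hub and a single further vertex. The hub then represents this block
  in the first transversal, and a surviving vertex \<open>z\<close> represents it in the second one.
\<close>

lemma packing_chromatic_number_blocks_del_nonhub:
  assumes "finite J" "\<And>j. j \<in> J \<Longrightarrow> s j \<ge> 1" and i: "i \<in> J" "b \<in> {1..s i + 1}"
  shows "packing_chromatic_number (block_graph (blocks s J - {prod_encode (i, b)})) = sum s J + 1"
proof -
  let ?W = "blocks s J - {prod_encode (i, b)}"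
  define z :: nat where "z = (if b = 1 then 2 else 1)"
  let ?a = "\<lambda>j. if j = i then 0 else 1 :: nat" and ?b = "\<lambda>j. if j = i then z else 2"
  have z: "z \<noteq> b" "z \<le> s i + 1" "z \<noteq> 0"
    using assms(2)[OF i(1)] i(2) by (auto simp: z_def)
  have hub: "\<exists>x\<in>?W. snd (prod_decode x) = 0 \<and> fst (prod_decode x) = fst (prod_decode u)"
    if "u \<in> blocks s J" for u
    using that i(2) by (elim blocksE) (auto intro!: bexI[of _ "prod_encode (fst (prod_decode u), 0)"])
  have grp: "(\<lambda>v. fst (prod_decode v)) ` ?W = J"
  proof
    show "(\<lambda>v. fst (prod_decode v)) ` ?W \<subseteq> J"
      using groups_blocks[of s J] by blast
    show "J \<subseteq> (\<lambda>v. fst (prod_decode v)) ` ?W"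
    proof
      fix j assume "j \<in> J"
      then show "j \<in> (\<lambda>v. fst (prod_decode v)) ` ?W"
        using i(2) by (intro image_eqI[of _ _ "prod_encode (j, 0)"]) auto
    qed
  qed
  have card: "card ?W + 1 = sum s J + 2 * card J"
    using card_Suc_Diff1[OF finite_blocks[OF assms(1)], of "prod_encode (i, b)" s] i
    by (simp add: card_blocks assms(1))
  have sum: "sum s J \<ge> 1"
    using assms(2)[OF i(1)] member_le_sum[of i J s] assms(1) i(1) by simp
  have "packing_chromatic_number (block_graph ?W) + 2 * card ((\<lambda>v. fst (prod_decode v)) ` ?W)
      = card ?W + 2"
  proof (rule packing_chromatic_number_hub_graph
      [of ?W ?W "(\<lambda>j. prod_encode (j, ?a j)) ` J" _ _ "(\<lambda>j. prod_encode (j, ?b j)) ` J"])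
    show "\<exists>x\<in>?W. snd (prod_decode x) = 0 \<and> fst (prod_decode x) = fst (prod_decode u)"
      if "u \<in> ?W" for u
      using that hub by blast
    show "bij_betw (\<lambda>v. fst (prod_decode v)) ((\<lambda>j. prod_encode (j, ?a j)) ` J)
        ((\<lambda>v. fst (prod_decode v)) ` ?W)"
      "bij_betw (\<lambda>v. fst (prod_decode v)) ((\<lambda>j. prod_encode (j, ?b j)) ` J)
        ((\<lambda>v. fst (prod_decode v)) ` ?W)"
      unfolding grp by (rule bij_betw_transversal)+
    show "?W \<noteq> {}" using grp i(1) by auto
    show "card (?W - ?W) + 2 * card ((\<lambda>v. fst (prod_decode v)) ` ?W) \<le> card ?W + 2"
      using card sum unfolding grp by simp
  qed (use assms z in \<open>auto simp: finite_blocks split: if_splits\<close>)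
  then show ?thesis using card unfolding grp by simp
qed

text \<open>
  The vertices of block \<open>i\<close> that are left form a hubless clique on \<open>s i + 1\<close> vertices; the bound on
  \<open>s i\<close> says that the colours needed for the other blocks suffice for it.
\<close>

lemma packing_chromatic_number_blocks_del_hub:
  assumes "finite J" "\<And>j. j \<in> J \<Longrightarrow> s j \<ge> 1" and i: "i \<in> J" "J - {i} \<noteq> {}"
    and s: "s i \<le> sum s (J - {i}) + 1"
  shows "packing_chromatic_number (block_graph (blocks s J - {prod_encode (i, 0)}))
    = sum s (J - {i}) + 2"
proof -
  let ?W = "blocks s J - {prod_encode (i, 0)}" and ?R = "blocks s (J - {i})"
  have card: "card ?R = sum s (J - {i}) + 2 * card (J - {i})"
    using assms(1) by (simp add: card_blocks)
  have diff: "?W - ?R = (\<lambda>b. prod_encode (i, b)) ` {1..s i + 1}"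
    using i(1) by (auto simp: Suc_le_eq elim!: blocksE)
  have card_diff: "card (?W - ?R) = s i + 1"
    unfolding diff by (subst card_image) (auto simp: inj_on_def)
  have "packing_chromatic_number (block_graph ?W) + 2 * card ((\<lambda>v. fst (prod_decode v)) ` ?R)
      = card ?R + 2"
  proof (rule packing_chromatic_number_hub_graph
      [of ?W ?R "(\<lambda>j. prod_encode (j, 1)) ` (J - {i})" _ _ "(\<lambda>j. prod_encode (j, 2)) ` (J - {i})"])
    show "\<exists>x\<in>?W. snd (prod_decode x) = 0 \<and> fst (prod_decode x) = fst (prod_decode u)"
      if "u \<in> ?R" for u
      using that by (elim blocksE) (auto intro!: bexI[of _ "prod_encode (fst (prod_decode u), 0)"])
    show "bij_betw (\<lambda>v. fst (prod_decode v)) ((\<lambda>j. prod_encode (j, 1)) ` (J - {i}))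
        ((\<lambda>v. fst (prod_decode v)) ` ?R)"
      "bij_betw (\<lambda>v. fst (prod_decode v)) ((\<lambda>j. prod_encode (j, 2)) ` (J - {i}))
        ((\<lambda>v. fst (prod_decode v)) ` ?R)"
      unfolding groups_blocks by (rule bij_betw_transversal)+
    show "?R \<noteq> {}" using i(2) by simp
    show "card (?W - ?R) + 2 * card ((\<lambda>v. fst (prod_decode v)) ` ?R) \<le> card ?R + 2"
      using s by (simp add: groups_blocks card card_diff)
    show "(\<lambda>v. fst (prod_decode v)) ` (?W - ?R) \<inter> (\<lambda>v. fst (prod_decode v)) ` ?R = {}"
      unfolding diff groups_blocks by auto
    show "snd (prod_decode w) \<noteq> 0" if "w \<in> ?W - ?R" for w
      using that unfolding diff by auto
    show "?R \<subseteq> ?W" by (auto elim!: blocksE)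
  qed (use assms in \<open>auto simp: finite_blocks\<close>)
  then show ?thesis by (simp add: groups_blocks card)
qed

text \<open>
  The condition \<open>J - {i} \<noteq> {}\<close> asks for at least two blocks, so that the deletion of a hub leaves a
  block with a hub.
\<close>

lemma critical_graph_exists:
  fixes s :: "nat \<Rightarrow> nat"
  assumes J: "finite J" "\<And>i. J - {i} \<noteq> {}"
    and pos: "\<And>j. j \<in> J \<Longrightarrow> s j \<ge> 1"
    and s: "\<And>i. i \<in> J \<Longrightarrow> s i \<le> sum s (J - {i}) + 1"
  shows "\<exists>G :: (nat, nat \<times> nat) pre_digraph.
           graph G \<and> verts G \<noteq> {} \<and> chi_rho_critical G \<and>
           {int (packing_chromatic_number G)
              - int (packing_chromatic_number (pre_digraph.del_vert G x)) | x. x \<in> verts G}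
           = int ` insert 1 (s ` J)"
proof -
  let ?W = "blocks s J"
  define G where "G = block_graph ?W"
  define gap where "gap x = int (packing_chromatic_number G)
      - int (packing_chromatic_number (pre_digraph.del_vert G x))" for x
  have "J \<noteq> {}" using J(2) by blast
  then obtain i where i: "i \<in> J" by blast
  have chi: "packing_chromatic_number G = sum s J + 2"
    unfolding G_def using J(1) \<open>J \<noteq> {}\<close> pos by (rule packing_chromatic_number_blocks)
  have gap_hub: "gap (prod_encode (j, 0)) = int (s j)" if "j \<in> J" for j
  proof -
    have "sum s J = s j + sum s (J - {j})"
      using J(1) that by (rule sum.remove)
    with chi show ?thesis
      using packing_chromatic_number_blocks_del_hub[of J s j] J pos s that
      by (simp add: gap_def G_def del_vert_hub_graph)
  qed
  have gap_nonhub: "gap (prod_encode (j, b)) = 1" if "j \<in> J" "b \<in> {1..s j + 1}" for j b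
    using packing_chromatic_number_blocks_del_nonhub[of J s j b] J(1) pos that chi
    by (simp add: gap_def G_def del_vert_hub_graph)
  have gap_cases: "gap x = 1 \<or> (\<exists>j\<in>J. gap x = int (s j))" if x: "x \<in> ?W" for x
  proof -
    obtain j b where "x = prod_encode (j, b)" "j \<in> J" "b \<le> s j + 1"
      using x by (rule blocksE)
    then show ?thesis
      using gap_hub[of j] gap_nonhub[of j b] by (cases "b = 0") auto
  qed
  have "{gap x | x. x \<in> ?W} = int ` insert 1 (s ` J)" (is "?L = ?R")
  proof
    show "?L \<subseteq> ?R" using gap_cases by fastforce
    have "int (s j) \<in> ?L" if "j \<in> J" for j
      using gap_hub[OF that] that by (auto intro!: exI[of _ "prod_encode (j, 0)"])
    moreover have "1 \<in> ?L"
      using gap_nonhub[OF i, of 1] i by (auto intro!: exI[of _ "prod_encode (i, 1)"])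
    ultimately show "?R \<subseteq> ?L" by auto
  qed
  moreover have "chi_rho_critical G"
    unfolding chi_rho_critical_def
  proof
    fix x assume "x \<in> verts G"
    then have "gap x > 0" using gap_cases[of x] pos by (fastforce simp: G_def)
    then show "packing_chromatic_number (pre_digraph.del_vert G x) < packing_chromatic_number G"
      by (simp add: gap_def)
  qed
  moreover have "graph G"
    unfolding G_def by (intro graph_hub_graph finite_blocks J(1))
  moreover have "verts G = ?W" by (simp add: G_def)
  moreover have "?W \<noteq> {}" using i by auto
  ultimately show ?thesis unfolding gap_def by (intro exI[of _ G]) simp
qed

theorem theorem3p1:
  fixes r :: nat and s :: "nat \<Rightarrow> nat" and S :: "nat set"
  assumes "r \<ge> 1"
    and "\<And>i. i \<in> {1..r} \<Longrightarrow> s i \<ge> 1"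
    and "S = insert 1 (s ` {1..r})"
    and "\<And>i. i \<in> {1..r} \<Longrightarrow> (\<Sum>j\<in>{1..r} - {i}. int (s j)) \<ge> int (s i) - 1"
  shows "\<exists>G :: (nat, nat \<times> nat) pre_digraph.
           graph G \<and> verts G \<noteq> {} \<and> chi_rho_critical G \<and>
           {int (packing_chromatic_number G)
              - int (packing_chromatic_number (pre_digraph.del_vert G x)) | x. x \<in> verts G}
           = int ` S"
proof (cases "r = 1")
  case True
  \<comment> \<open>A single block is not covered by the construction, but two blocks with parameter 1 yield
    the same set.\<close>
  then have "s 1 = 1" using assms(2,4)[of 1] by simp
  with True have "S = insert 1 ((\<lambda>_. 1) ` {1, 2 :: nat})"
    using assms(3) by auto
  moreover have "{1, 2} - {i} \<noteq> {}" for i :: nat by auto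
  ultimately show ?thesis
    using critical_graph_exists[of "{1, 2}" "\<lambda>_. 1"] by simp
next
  case False
  have "{1..r} - {i} \<noteq> {}" for i
  proof -
    have "1 \<in> {1..r} - {i} \<or> 2 \<in> {1..r} - {i}" using False assms(1) by auto
    then show ?thesis by blast
  qed
  moreover have "s i \<le> sum s ({1..r} - {i}) + 1" if "i \<in> {1..r}" for i
    using assms(4)[OF that] by (simp flip: of_nat_sum)
  ultimately show ?thesis
    unfolding assms(3) using assms(2) by (intro critical_graph_exists) auto
qed

end
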